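(* Let $A, E\in\mathbb{C}^{n\times n}$ with $E$ invertible and Hermitian, and let $\mathrm{ind}(A)=k$. Suppose that the $E$-weighted core-EP inverse $A^{\mathrm{ep},E}$ exists, and let $X=A^*AA^{\mathrm{ep},E}$ be the star $E$-weighted core-EP matrix of $A$. Then: (i) $(A^\dagger)^*X$ is a projector onto $R(A^k)$ along $N(A^{\mathrm{ep},E})$. (ii) $X(A^\dagger)^*$ is a projector onto $R(A^*A^k)$ along $N(A^{\mathrm{ep},E}(A^\dagger)^* )$. (iii) $\left[(A^\dagger)^*\right]^{(2)}_{R(A^*A^k),\,N(A^{\mathrm{ep},E})}=X$.
   Context: $A^*$ is the conjugate transpose of $A$, $A^\dagger$ is the (ordinary) Moore-Penrose inverse of $A$, and $R(\cdot)$, $N(\cdot)$ denote range (column space) and null space. The index $\mathrm{ind}(A)$ is the smallest non-negative integer $k$ with $\mathrm{rank}(A^k)=\mathrm{rank}(A^{k+1})$ (with $A^0=I$). For $\mathrm{ind}(A)=k$ and $E$ invertible Hermitian, a matrix $X\in\mathbb{C}^{n\times n}$ is called the $E$-weighted core-EP inverse of $A$, denoted $A^{\mathrm{ep},E}$, if $XA^{k+1}=A^k$, $AX^2=X$, and $(EAX)^*=EAX$; such an $X$ is unique when it exists. A projector onto $T$ along $S$ is an idempotent matrix with range $T$ and null space $S$. For a matrix $M$ and subspaces $T,S$, $M^{(2)}_{T,S}$ denotes the (unique, when it exists) matrix $X$ with $XMX=X$, $R(X)=T$ and $N(X)=S$; the equality in (iii) includes the assertion that this outer inverse exists. *)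

theory Defs
  imports "HOL-Analysis.Analysis"
begin

definition ctranspose :: "complex^'n^'m \<Rightarrow> complex^'m^'n" where
  "ctranspose A = map_matrix cnj (transpose A)"

definition hermitian :: "complex^'n^'n \<Rightarrow> bool" where
  "hermitian A \<longleftrightarrow> ctranspose A = A"

text \<open>The power operation that type \<^typ>\<open>complex^'n^'n\<close> inherits from the
  library is componentwise, so powers with respect to the matrix product are
  defined here.\<close>

primrec mat_pow :: "'a::semiring_1^'n^'n \<Rightarrow> nat \<Rightarrow> 'a^'n^'n" where
  "mat_pow A 0 = mat 1"
| "mat_pow A (Suc k) = A ** mat_pow A k"

definition mat_range :: "'a::semiring_1^'n^'m \<Rightarrow> ('a^'m) set" where
  "mat_range A = range (\<lambda>x. A *v x)"

definition null_space :: "'a::semiring_1^'n^'m \<Rightarrow> ('a^'n) set" where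
  "null_space A = {x. A *v x = 0}"

definition mat_index :: "'a::field^'n^'n \<Rightarrow> nat" where
  "mat_index A = (LEAST k. rank (mat_pow A k) = rank (mat_pow A (k + 1)))"

definition is_moore_penrose :: "complex^'n^'m \<Rightarrow> complex^'m^'n \<Rightarrow> bool" where
  "is_moore_penrose A X \<longleftrightarrow>
     A ** X ** A = A \<and> X ** A ** X = X \<and> hermitian (A ** X) \<and> hermitian (X ** A)"

definition moore_penrose :: "complex^'n^'m \<Rightarrow> complex^'m^'n" where
  "moore_penrose A = (THE X. is_moore_penrose A X)"

definition is_core_ep :: "complex^'n^'n \<Rightarrow> complex^'n^'n \<Rightarrow> complex^'n^'n \<Rightarrow> bool" where
  "is_core_ep E A X \<longleftrightarrow>
     X ** mat_pow A (mat_index A + 1) = mat_pow A (mat_index A) \<and>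
     A ** mat_pow X 2 = X \<and>
     hermitian (E ** A ** X)"

text \<open>For invertible Hermitian \<open>E\<close> there is at most one \<open>X\<close> with
  \<^term>\<open>is_core_ep E A X\<close>, but there may be none; the value of
  \<open>core_ep E A\<close> is meaningful only if one exists.\<close>

definition core_ep :: "complex^'n^'n \<Rightarrow> complex^'n^'n \<Rightarrow> complex^'n^'n" where
  "core_ep E A = (THE X. is_core_ep E A X)"

definition is_projector :: "'a::semiring_1^'n^'n \<Rightarrow> ('a^'n) set \<Rightarrow> ('a^'n) set \<Rightarrow> bool" where
  "is_projector P T S \<longleftrightarrow> P ** P = P \<and> mat_range P = T \<and> null_space P = S"

definition is_outer_inverse ::
    "'a::semiring_1^'n^'m \<Rightarrow> ('a^'n) set \<Rightarrow> ('a^'m) set \<Rightarrow> 'a^'m^'n \<Rightarrow> bool" where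
  "is_outer_inverse M T S X \<longleftrightarrow>
     X ** M ** X = X \<and> mat_range X = T \<and> null_space X = S"

text \<open>There is at most one outer inverse of \<open>M\<close> with given range and null space;
  as for \<open>core_ep\<close>, existence has to be asserted separately.\<close>

definition outer_inverse ::
    "'a::semiring_1^'n^'m \<Rightarrow> ('a^'n) set \<Rightarrow> ('a^'m) set \<Rightarrow> 'a^'m^'n" where
  "outer_inverse M T S = (THE X. is_outer_inverse M T S X)"

end

(*
  The normal equations give A^+ as a product of a {1,4}- and a {1,3}-inverse of A, each
  obtained from an arbitrary inner inverse of a Gram matrix. Let Z be the E-weighted core-EP
  inverse. Then Z = A^m Z^(m+1) for all m, whence ZAZ = Z, so AZ is idempotent with range
  R(A^k) and null space N(Z). Since (A^+)^* A^* A = A, multiplying X = A^* A Z by (A^+)^* on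
  the left gives AZ, and the claims follow.
*)
theory Submission
  imports Defs
begin

section \<open>Conjugate transposes\<close>

lemma ctranspose_nth: "ctranspose A $ i $ j = cnj (A $ j $ i)"
  by (simp add: ctranspose_def transpose_def)

lemma ctranspose_ctranspose [simp]: "ctranspose (ctranspose A) = A"
  by (simp add: vec_eq_iff ctranspose_nth)

lemma ctranspose_mult: "ctranspose (A ** B) = ctranspose B ** ctranspose A"
  by (simp add: vec_eq_iff ctranspose_nth matrix_matrix_mult_def mult.commute)

lemma hermitian_gram: "hermitian (ctranspose A ** A)"
  by (simp add: hermitian_def ctranspose_mult)

text \<open>Each diagonal entry of A^* A is the squared norm of a column of A.\<close>

lemma gram_eq_0:
  fixes A :: "complex^'n^'m"
  assumes "ctranspose A ** A = 0"
  shows "A = 0"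
proof -
  have "A $ i $ j = 0" for i j
  proof -
    have "(\<Sum>l\<in>UNIV. cnj (A $ l $ j) * A $ l $ j) = (ctranspose A ** A) $ j $ j"
      by (simp add: matrix_matrix_mult_def ctranspose_nth)
    also have "\<dots> = 0"
      using assms by simp
    finally have "complex_of_real (\<Sum>l\<in>UNIV. (cmod (A $ l $ j))\<^sup>2) = 0"
      by (simp add: complex_norm_square mult.commute del: of_real_power)
    then have "(\<Sum>l\<in>UNIV. (cmod (A $ l $ j))\<^sup>2) = 0"
      using of_real_eq_0_iff by blast
    then show ?thesis
      by (simp add: sum_nonneg_eq_0_iff)
  qed
  then show ?thesis
    by (simp add: vec_eq_iff)
qed

lemma matrix_diff_ldistrib: "A ** (B - C) = A ** B - A ** C" for A :: "'a::ring_1^'n^'m"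
  by (simp add: vec_eq_iff matrix_matrix_mult_def right_diff_distrib sum_subtractf)

text \<open>For D = A (B - C), the assumption gives A^* D = 0, hence D^* D = (B - C)^* A^* D =
  0.\<close>

lemma gram_mult_cancel:
  fixes A :: "complex^'n^'m" and B C :: "complex^'p^'n"
  assumes "ctranspose A ** A ** B = ctranspose A ** A ** C"
  shows "A ** B = A ** C"
proof -
  let ?D = "A ** (B - C)"
  have "ctranspose A ** ?D = ctranspose A ** A ** B - ctranspose A ** A ** C"
    by (simp add: matrix_mul_assoc matrix_diff_ldistrib)
  then have "ctranspose ?D ** ?D = 0"
    using assms by (simp add: ctranspose_mult flip: matrix_mul_assoc)
  then have "?D = 0"
    by (rule gram_eq_0)
  then show ?thesis
    by (simp add: matrix_diff_ldistrib)
qed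

section \<open>The Moore-Penrose inverse\<close>

lemma inner_inverse_exists:
  fixes A :: "'a::field^'n^'m"
  shows "\<exists>G. A ** G ** A = A"
proof -
  obtain g where g: "Vector_Spaces.linear (*s) (*s) g"
    and inv: "\<And>y. y \<in> range (\<lambda>x. A *v x) \<Longrightarrow> A *v g y = y"
    using vec.linear_exists_right_inverse_on[OF matrix_vector_mul_linear_gen[of A] vec.subspace_UNIV]
    by blast
  have "A ** matrix g ** A = A"
    unfolding matrix_eq using inv by (simp add: matrix_works[OF g] flip: matrix_vector_mul_assoc)
  then show ?thesis ..
qed

text \<open>The witness is G A^*, with G an inner inverse of the Gram matrix A^* A, as in least
  squares.\<close>

lemma inverse_13_exists:
  fixes A :: "complex^'n^'m"
  shows "\<exists>B. A ** B ** A = A \<and> hermitian (A ** B)"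
proof -
  let ?A' = "ctranspose A"
  obtain G where G: "?A' ** A ** G ** (?A' ** A) = ?A' ** A"
    using inner_inverse_exists[of "?A' ** A"] by blast
  \<comment> \<open>The Gram matrix is Hermitian, so G^* is an inner inverse of it as well.\<close>
  then have "ctranspose (?A' ** A ** G ** (?A' ** A)) = ctranspose (?A' ** A)"
    by simp
  then have G': "?A' ** A ** ctranspose G ** (?A' ** A) = ?A' ** A"
    by (simp add: ctranspose_mult matrix_mul_assoc)
  have *: "A ** H ** ?A' ** A = A" if "?A' ** A ** H ** (?A' ** A) = ?A' ** A" for H
    using that gram_mult_cancel[of A "H ** (?A' ** A)" "mat 1"]
    by (simp add: matrix_mul_assoc)
  let ?P = "A ** G ** ?A'"
  \<comment> \<open>P^* P = (A G^* A^* A) G A^* = A G A^* = P. This writes P as a Gram matrix, which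
    makes it Hermitian.\<close>
  have "ctranspose ?P ** ?P = ?P"
    using *[OF G'] by (simp add: ctranspose_mult matrix_mul_assoc)
  with hermitian_gram[of ?P] have "hermitian ?P"
    by simp
  with *[OF G] show ?thesis
    by (metis matrix_mul_assoc)
qed

lemma moore_penrose_exists:
  fixes A :: "complex^'n^'m"
  shows "\<exists>X. is_moore_penrose A X"
proof -
  obtain B where B: "A ** B ** A = A" "hermitian (A ** B)"
    using inverse_13_exists by blast
  obtain C' where C': "ctranspose A ** C' ** ctranspose A = ctranspose A" "hermitian (ctranspose A ** C')"
    using inverse_13_exists by blast
  \<comment> \<open>The adjoint of a {1,3}-inverse of A^* is a {1,4}-inverse of A.\<close>
  define C where "C = ctranspose C'"
  have "A ** C ** A = ctranspose (ctranspose A ** C' ** ctranspose A)"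
    by (simp add: C_def ctranspose_mult matrix_mul_assoc)
  then have C: "A ** C ** A = A"
    by (simp add: C'(1))
  have "hermitian (C ** A)"
    using C'(2) by (simp add: C_def hermitian_def ctranspose_mult)
  \<comment> \<open>For C A B, one product with A reduces to A B and the other to C A, and both are
    Hermitian.\<close>
  moreover have "A ** (C ** A ** B) = A ** B" "C ** A ** B ** A = C ** A"
    using B(1) C by (simp_all add: matrix_mul_assoc) (metis matrix_mul_assoc)
  moreover have "C ** A ** (C ** A ** B) = C ** A ** B"
    using C by (metis matrix_mul_assoc)
  ultimately have "is_moore_penrose A (C ** A ** B)"
    using B unfolding is_moore_penrose_def by simp
  then show ?thesis ..
qed

text \<open>Taking adjoints in A Y A X = A X gives A X A Y = A X, while A X A Y = A Y; likewise X A
  = Y A. Then X = X A X = X A Y = Y A Y = Y.\<close>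

lemma moore_penrose_unique:
  assumes "is_moore_penrose A X" "is_moore_penrose A Y"
  shows "X = Y"
proof -
  have X: "A ** X ** A = A" "X ** A ** X = X" "ctranspose (A ** X) = A ** X" "ctranspose (X ** A) = X ** A"
    and Y: "A ** Y ** A = A" "Y ** A ** Y = Y" "ctranspose (A ** Y) = A ** Y" "ctranspose (Y ** A) = Y ** A"
    using assms by (auto simp: is_moore_penrose_def hermitian_def)
  have "A ** X = ctranspose (A ** Y ** (A ** X))"
    using X(3) Y(1) by (simp add: matrix_mul_assoc)
  also have "\<dots> = A ** X ** (A ** Y)"
    by (simp add: ctranspose_mult[of "A ** Y"] X(3) Y(3))
  also have "\<dots> = A ** Y"
    by (simp add: matrix_mul_assoc X(1))
  finally have AX: "A ** X = A ** Y" .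
  have "X ** A = ctranspose (X ** A ** (Y ** A))"
    using X(4) Y(1) by (metis matrix_mul_assoc)
  also have "\<dots> = Y ** A ** (X ** A)"
    by (simp add: ctranspose_mult[of "X ** A"] X(4) Y(4))
  also have "\<dots> = Y ** A"
    by (metis matrix_mul_assoc X(1))
  finally have XA: "X ** A = Y ** A" .
  show ?thesis
    by (metis AX XA X(2) Y(2) matrix_mul_assoc)
qed

lemma is_moore_penrose_moore_penrose: "is_moore_penrose A (moore_penrose A)"
  unfolding moore_penrose_def
  using moore_penrose_exists moore_penrose_unique by (metis theI)

section \<open>Ranges, null spaces and outer inverses\<close>

lemma mat_range_mult: "mat_range (A ** B) = (\<lambda>x. A *v x) ` mat_range B"
  by (auto simp: mat_range_def image_image simp flip: matrix_vector_mul_assoc)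

lemma mat_range_mult_subset: "mat_range (A ** B) \<subseteq> mat_range A"
  by (auto simp: mat_range_def simp flip: matrix_vector_mul_assoc)

lemma null_space_mult_supset: "null_space B \<subseteq> null_space (A ** B)"
  by (auto simp: null_space_def simp flip: matrix_vector_mul_assoc)

text \<open>The vector v - M Y v lies in N(Y) = N(X), so X v = X M Y v; and X M fixes Y v because
  R(Y) = R(X).\<close>

lemma outer_inverse_unique:
  fixes M :: "'a::ring_1^'n^'m"
  assumes "is_outer_inverse M T S X" "is_outer_inverse M T S Y"
  shows "X = Y"
proof -
  have X: "X ** M ** X = X" and Y: "Y ** M ** Y = Y"
    and R: "mat_range X = mat_range Y" and N: "null_space X = null_space Y"
    using assms by (auto simp: is_outer_inverse_def)
  have "X *v v = Y *v v" for v
  proof -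
    have "Y *v (v - M *v (Y *v v)) = 0"
      by (simp add: matrix_vector_mult_diff_distrib matrix_vector_mul_assoc Y matrix_mul_assoc)
    then have "X *v (v - M *v (Y *v v)) = 0"
      using N by (auto simp: null_space_def)
    then have "X *v v = X *v (M *v (Y *v v))"
      by (simp add: matrix_vector_mult_diff_distrib)
    moreover obtain w where w: "Y *v v = X *v w"
      using R unfolding mat_range_def by (metis rangeE rangeI)
    then have "X *v (M *v (Y *v v)) = Y *v v"
      by (simp add: matrix_vector_mul_assoc X matrix_mul_assoc)
    ultimately show ?thesis
      by simp
  qed
  then show ?thesis
    by (simp add: matrix_eq)
qed

section \<open>The weighted core-EP inverse\<close>

lemma mat_pow_Suc_right: "mat_pow A (Suc k) = mat_pow A k ** A"
  by (induction k) (simp_all add: matrix_mul_assoc)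

lemma mat_pow_mult_absorb:
  assumes "A ** mat_pow Z 2 = Z"
  shows "mat_pow A m ** mat_pow Z (Suc m) = Z"
proof (induction m)
  case (Suc m)
  have "mat_pow A (Suc m) ** mat_pow Z (Suc (Suc m)) = A ** (mat_pow A m ** mat_pow Z (Suc m)) ** Z"
    by (simp add: matrix_mul_assoc mat_pow_Suc_right[of Z] del: mat_pow.simps(2))
      (simp add: matrix_mul_assoc)
  also have "\<dots> = Z"
    using assms Suc by (simp add: numeral_2_eq_2 matrix_mul_assoc)
  finally show ?case .
qed simp

text \<open>Z A fixes the columns of A^k, and Y = A^k Y^(k+1). Two solutions are allowed for the
  sake of uniqueness; Y = Z gives Z A Z = Z.\<close>

lemma core_ep_mult_right:
  assumes "is_core_ep E A Y" "is_core_ep E A Z"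
  shows "Z ** A ** Y = Y"
proof -
  let ?k = "mat_index A"
  have "Z ** (A ** Y) = Z ** (A ** (mat_pow A ?k ** mat_pow Y (Suc ?k)))"
    using assms(1) by (simp add: mat_pow_mult_absorb is_core_ep_def del: mat_pow.simps)
  also have "\<dots> = Z ** mat_pow A (?k + 1) ** mat_pow Y (Suc ?k)"
    by (simp add: matrix_mul_assoc)
  also have "\<dots> = mat_pow A ?k ** mat_pow Y (Suc ?k)"
    using assms(2) by (simp add: is_core_ep_def)
  also have "\<dots> = Y"
    using assms(1) by (intro mat_pow_mult_absorb) (simp add: is_core_ep_def)
  finally show ?thesis
    by (simp add: matrix_mul_assoc)
qed

text \<open>Substituting A^k = Z A^(k+1) turns A Z A^k into A Z^2 A^(k+1) = Z A^(k+1).\<close>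

lemma core_ep_mult_power:
  assumes "is_core_ep E A Z"
  shows "A ** Z ** mat_pow A (mat_index A) = mat_pow A (mat_index A)"
proof -
  let ?k = "mat_index A"
  have *: "Z ** mat_pow A (?k + 1) = mat_pow A ?k" and Z2: "A ** mat_pow Z 2 = Z"
    using assms by (simp_all add: is_core_ep_def)
  have "A ** Z ** mat_pow A ?k = A ** mat_pow Z 2 ** mat_pow A (?k + 1)"
    using * by (simp add: numeral_2_eq_2) (metis matrix_mul_assoc)
  then show ?thesis
    using * Z2 by simp
qed

text \<open>A Y and A Z are idempotents with the same range, both self-adjoint for the form given by
  E, so they coincide; then Y = Z A Y = Z A Z = Z.\<close>

lemma core_ep_unique:
  assumes "invertible E" "hermitian E" "is_core_ep E A Y" "is_core_ep E A Z"
  shows "Y = Z"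
proof -
  have *: "ctranspose (E ** (A ** V)) = E ** (A ** V)" if "is_core_ep E A V" for V
    using that by (simp add: is_core_ep_def hermitian_def matrix_mul_assoc)
  have E: "ctranspose E = E"
    using assms by (simp add: hermitian_def)
  let ?P = "A ** Y" and ?Q = "A ** Z"
  have QP: "?Q ** ?P = ?P" and PQ: "?P ** ?Q = ?Q"
    using core_ep_mult_right assms(3,4) by (metis matrix_mul_assoc)+
  have EP: "E ** ?P = ctranspose ?P ** E" and EQ: "E ** ?Q = ctranspose ?Q ** E"
    using *[OF assms(3)] *[OF assms(4)] E by (metis ctranspose_mult)+
  \<comment> \<open>The chain is E Q = E P Q = P^* E Q = P^* Q^* E = (Q P)^* E = P^* E = E
    P.\<close>
  have "E ** ?Q = ctranspose ?P ** (E ** ?Q)"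
    using PQ EP by (metis matrix_mul_assoc)
  also have "\<dots> = ctranspose (?Q ** ?P) ** E"
    by (metis EQ ctranspose_mult matrix_mul_assoc)
  also have "\<dots> = E ** ?P"
    by (simp only: QP EP)
  finally have "E ** ?Q = E ** ?P" .
  then have "?Q = ?P"
    using assms(1) by (metis invertible_def matrix_mul_assoc matrix_mul_lid)
  then show ?thesis
    using core_ep_mult_right assms(3,4) by (metis matrix_mul_assoc)
qed

lemma is_core_ep_core_ep:
  assumes "invertible E" "hermitian E" "\<exists>Y. is_core_ep E A Y"
  shows "is_core_ep E A (core_ep E A)"
  unfolding core_ep_def using assms core_ep_unique by (metis theI)

text \<open>One inclusion uses Z = A^k Z^(k+1) and that A commutes with A^k, the other A Z A^k =
  A^k.\<close>

lemma mat_range_core_ep: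
  assumes "is_core_ep E A Z"
  shows "mat_range (A ** Z) = mat_range (mat_pow A (mat_index A))"
proof
  let ?k = "mat_index A"
  have "A ** Z = A ** (mat_pow A ?k ** mat_pow Z (Suc ?k))"
    using assms by (simp add: mat_pow_mult_absorb is_core_ep_def del: mat_pow.simps)
  also have "\<dots> = mat_pow A ?k ** (A ** mat_pow Z (Suc ?k))"
    using mat_pow_Suc_right[of A ?k] by (simp add: matrix_mul_assoc)
  finally show "mat_range (A ** Z) \<subseteq> mat_range (mat_pow A ?k)"
    by (metis mat_range_mult_subset)
  show "mat_range (mat_pow A ?k) \<subseteq> mat_range (A ** Z)"
    by (metis core_ep_mult_power[OF assms] mat_range_mult_subset)
qed

theorem theorem4p7:
  fixes A E X :: "complex^'n^'n" and k :: nat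
  assumes "invertible E" and "hermitian E"
    and "mat_index A = k"
    and "\<exists>Y. is_core_ep E A Y"
    and "X = ctranspose A ** A ** core_ep E A"
  shows "is_projector (ctranspose (moore_penrose A) ** X)
           (mat_range (mat_pow A k)) (null_space (core_ep E A)) \<and>
         is_projector (X ** ctranspose (moore_penrose A))
           (mat_range (ctranspose A ** mat_pow A k))
           (null_space (core_ep E A ** ctranspose (moore_penrose A))) \<and>
         (\<exists>Y. is_outer_inverse (ctranspose (moore_penrose A))
                (mat_range (ctranspose A ** mat_pow A k)) (null_space (core_ep E A)) Y) \<and>
         outer_inverse (ctranspose (moore_penrose A))
           (mat_range (ctranspose A ** mat_pow A k)) (null_space (core_ep E A)) = X"
proof -
  define Z where "Z = core_ep E A"
  define M where "M = ctranspose (moore_penrose A)"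
  let ?A' = "ctranspose A"
  have core: "is_core_ep E A Z"
    unfolding Z_def using assms(1,2,4) by (rule is_core_ep_core_ep)
  have ZAZ: "Z ** A ** Z = Z"
    using core core by (rule core_ep_mult_right)
  have AZAk: "A ** Z ** mat_pow A k = mat_pow A k"
    using core_ep_mult_power[OF core] assms(3) by simp
  have X: "X = ?A' ** A ** Z"
    using assms(5) by (simp add: Z_def)
  have mp: "A ** moore_penrose A ** A = A" "ctranspose (A ** moore_penrose A) = A ** moore_penrose A"
    using is_moore_penrose_moore_penrose[of A] by (auto simp: is_moore_penrose_def hermitian_def)
  \<comment> \<open>M A^* = (A A^+)^* = A A^+, the orthogonal projector onto R(A).\<close>
  have MA'A: "M ** ?A' ** A = A"
    using mp by (simp add: M_def flip: ctranspose_mult)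
  have MX: "M ** X = A ** Z"
    unfolding X using MA'A by (simp add: matrix_mul_assoc)
  \<comment> \<open>A^k = A Z A^k puts the columns of A^k into R(A), also for k = 0.\<close>
  have MA'Ak: "M ** ?A' ** mat_pow A k = mat_pow A k"
    using MA'A AZAk by (metis matrix_mul_assoc)
  have range_AZ: "mat_range (A ** Z) = mat_range (mat_pow A k)"
    using mat_range_core_ep[OF core] assms(3) by simp
  have range_X: "mat_range X = mat_range (?A' ** mat_pow A k)"
    by (metis X range_AZ mat_range_mult matrix_mul_assoc)
  \<comment> \<open>X = A^* A Z and Z = Z A Z = Z M X, so each of X W and Z W is a left multiple of
    the other. W = I serves (iii), W = M serves (ii).\<close>
  have null: "null_space (X ** W) = null_space (Z ** W)" for W :: "complex^'n^'n"
  proof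
    have "Z ** W = Z ** M ** (X ** W)"
      using MX ZAZ by (metis matrix_mul_assoc)
    then show "null_space (X ** W) \<subseteq> null_space (Z ** W)"
      by (metis null_space_mult_supset)
    have "X ** W = ?A' ** A ** (Z ** W)"
      by (simp add: X matrix_mul_assoc)
    then show "null_space (Z ** W) \<subseteq> null_space (X ** W)"
      by (metis null_space_mult_supset)
  qed
  have null_X: "null_space X = null_space Z"
    using null[of "mat 1"] by simp
  have null_AZ: "null_space (A ** Z) = null_space Z"
    using null_space_mult_supset[of Z A] null_space_mult_supset[of "A ** Z" Z] ZAZ
    by (simp add: matrix_mul_assoc)
  have XMX: "X ** M ** X = X"
    using MX X ZAZ by (metis matrix_mul_assoc)

  have 1: "is_projector (M ** X) (mat_range (mat_pow A k)) (null_space Z)"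
    unfolding is_projector_def MX range_AZ null_AZ using ZAZ by (metis matrix_mul_assoc)
  \<comment> \<open>X M A^* A^k = X A^k = A^* A Z A^k = A^* A^k, so R(X M) contains R(A^* A^k) =
    R(X); the reverse inclusion is immediate.\<close>
  have "X ** M ** (?A' ** mat_pow A k) = ?A' ** mat_pow A k"
    using MA'Ak AZAk X by (metis matrix_mul_assoc)
  then have "mat_range (X ** M) = mat_range (?A' ** mat_pow A k)"
    using mat_range_mult_subset range_X by (metis subset_antisym)
  then have 2: "is_projector (X ** M) (mat_range (?A' ** mat_pow A k)) (null_space (Z ** M))"
    unfolding is_projector_def using XMX null by (simp add: matrix_mul_assoc)
  have 3: "is_outer_inverse M (mat_range (?A' ** mat_pow A k)) (null_space Z) X"
    unfolding is_outer_inverse_def using XMX range_X null_X by simp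
  then have "outer_inverse M (mat_range (?A' ** mat_pow A k)) (null_space Z) = X"
    unfolding outer_inverse_def using outer_inverse_unique by blast
  with 1 2 3 show ?thesis
    unfolding M_def Z_def by blast
qed

end
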